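(* Let $a$ and $n$ be positive integers. Suppose $a$ is even, $n$ is odd, and $a^{n}+1$ is the sum of two squares. Then: (i) if $a+1$ is the sum of two squares, then $a^{\delta}+1$ is the sum of two squares for all positive divisors $\delta$ of $n$; and (ii) if $a+1$ is not the sum of two squares, then there is a unique prime number $p \equiv 3 \pmod{4}$ such that $p^{r} \,\|\, a+1$ for some odd $r$, and $n=p$.
   Context: An integer $N$ is "the sum of two squares" if $N = s^2+t^2$ for some integers $s,t$ (zero is allowed). For a prime $p$ and a positive integer $N$, $p^{r}\,\|\,N$ means $p^{r}\mid N$ but $p^{r+1}\nmid N$. *)

theory Defs
  imports "HOL-Number_Theory.Number_Theory"
begin

definition sum_of_two_squares :: "int \<Rightarrow> bool" where
  "sum_of_two_squares N \<longleftrightarrow> (\<exists>s t :: int. N = s\<^sup>2 + t\<^sup>2)"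

definition exactly_divides :: "nat \<Rightarrow> nat \<Rightarrow> nat \<Rightarrow> bool" where
  \<comment> \<open>\<open>exactly_divides p r N\<close> is the relation written \<open>p\<^sup>r \<parallel> N\<close>.\<close>
  "exactly_divides p r N \<longleftrightarrow> p ^ r dvd N \<and> \<not> p ^ (r + 1) dvd N"

definition odd_exponent_prime :: "nat \<Rightarrow> nat \<Rightarrow> bool" where
  "odd_exponent_prime p N \<longleftrightarrow>
     prime p \<and> [p = 3] (mod 4) \<and> (\<exists>r. odd r \<and> exactly_divides p r N)"

end

theory Submission
  imports Defs "HOL-Library.Discrete_Functions"
begin

text \<open>
  By the two-squares theorem, a positive integer is a sum of two squares if and only if every prime
  \<open>q \<equiv> 3 (mod 4)\<close> divides it to an even power. The hypothesis says this about \<open>a\<^sup>n + 1\<close>, and the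
  question is how the exponent of \<open>q\<close> changes on passing from \<open>a\<^sup>n + 1\<close> to a factor
  \<open>a\<^sup>\<delta> + 1\<close>. If \<open>q\<close> divides \<open>c + 1\<close> and \<open>m\<close> is odd, then the cofactor
  \<open>(c\<^sup>m + 1) / (c + 1) = 1 - c + c\<^sup>2 - \<dots> + c\<^bsup>m-1\<^esup>\<close> is congruent to \<open>m\<close> modulo \<open>q\<close>, so the
  exponent of \<open>q\<close> can change only if \<open>q\<close> divides \<open>m\<close>, and hence \<open>n\<close>.

  Everything therefore rests on lemma \<open>exponent_eq_prime_divisor\<close>: a prime \<open>q \<equiv> 3 (mod 4)\<close> dividing
  both \<open>n\<close> and \<open>a\<^sup>n + 1\<close> must equal \<open>n\<close>. Put \<open>e = n / q\<close>, \<open>b = a\<^sup>e\<close> and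
  \<open>Q = (b\<^sup>q + 1) / (b + 1)\<close>. Fermat's little theorem gives \<open>q dvd b + 1\<close>, and then \<open>q\<close> divides \<open>Q\<close>
  exactly once. A prime \<open>r \<noteq> q\<close> dividing \<open>Q\<close> cannot divide \<open>b + 1\<close>, because \<open>Q \<equiv> q\<close> modulo every
  divisor of \<open>b + 1\<close>; so its exponent in \<open>Q\<close> is its exponent in \<open>a\<^sup>n + 1\<close>, which is even when
  \<open>r \<equiv> 3 (mod 4)\<close>. Hence \<open>Q\<close> is \<open>q\<close> times an odd sum of two squares, and \<open>Q \<equiv> 3 (mod 4)\<close>. If \<open>e\<close>
  were greater than 1, then \<open>4 dvd b\<close>, as \<open>a\<close> is even, and so \<open>Q \<equiv> 1 (mod 4)\<close>, a contradiction.

  Part (i) follows: for a proper divisor \<open>\<delta> > 1\<close> of \<open>n\<close>, no prime \<open>q \<equiv> 3 (mod 4)\<close> that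
  divides \<open>a\<^sup>\<delta> + 1\<close> can divide \<open>n\<close>, since \<open>q = n\<close> would make \<open>n\<close> prime, and so its exponents in
  \<open>a\<^sup>\<delta> + 1\<close> and \<open>a\<^sup>n + 1\<close> agree. For part (ii), a prime \<open>p \<equiv> 3 (mod 4)\<close> with odd exponent in
  \<open>a + 1\<close> exists by the two-squares theorem; each such \<open>p\<close> has even exponent in \<open>a\<^sup>n + 1\<close>, so it
  divides \<open>n\<close> and thus equals \<open>n\<close>.
\<close>

section \<open>The two-squares theorem\<close>

lemma sum_of_two_squares_mult:
  assumes "sum_of_two_squares M" and "sum_of_two_squares N"
  shows "sum_of_two_squares (M * N)"
proof -
  obtain s t u v where "M = s\<^sup>2 + t\<^sup>2" "N = u\<^sup>2 + v\<^sup>2"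
    using assms unfolding sum_of_two_squares_def by blast
  then have "M * N = (s * u - t * v)\<^sup>2 + (s * v + t * u)\<^sup>2"
    by (simp add: power2_eq_square algebra_simps)
  then show ?thesis
    unfolding sum_of_two_squares_def by blast
qed

lemma odd_sum_of_two_squares_cong_1:
  assumes "sum_of_two_squares N" and "odd N"
  shows "[N = 1] (mod 4)"
proof -
  have sq: "x\<^sup>2 mod 4 = (if even x then 0 else 1)" for x :: int
  proof (cases "even x")
    case True
    then show ?thesis by (auto simp: power2_eq_square elim!: evenE)
  next
    case False
    then obtain k where "x = 2 * k + 1" by (elim oddE)
    then have "x\<^sup>2 = 4 * (k * k + k) + 1" by (simp add: power2_eq_square algebra_simps)
    then show ?thesis using False by (simp add: mod_add_left_eq[symmetric])
  qed
  obtain s t where N: "N = s\<^sup>2 + t\<^sup>2"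
    using assms(1) unfolding sum_of_two_squares_def by blast
  have "N mod 4 = (s\<^sup>2 mod 4 + t\<^sup>2 mod 4) mod 4"
    by (simp add: N mod_add_eq)
  then show ?thesis
    using assms(2) N by (cases "even s"; cases "even t") (auto simp: sq cong_def)
qed

lemma fermat_int:
  fixes x :: int
  assumes "prime p" and "\<not> int p dvd x"
  shows "[x ^ (p - 1) = 1] (mod int p)"
proof -
  have "\<not> p dvd nat (x mod int p)"
    using assms prime_gt_0_nat[OF assms(1)] 
    by (metis dvd_mod_iff dvd_refl int_dvd_int_iff int_nat_eq of_nat_0_less_iff pos_mod_sign)
  from fermat_theorem[OF assms(1) this]
  have "[int (nat (x mod int p)) ^ (p - 1) = 1] (mod int p)"
    by (metis cong_int_iff of_nat_1 of_nat_power)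
  moreover have "int (nat (x mod int p)) = x mod int p"
    using prime_gt_0_nat[OF assms(1)] by simp
  ultimately show ?thesis
    by (simp add: cong_def power_mod)
qed

text \<open>
  For \<open>p = 4 k + 3\<close> the exponent \<open>(p - 1) / 2 = 2 k + 1\<close> is odd. Raising \<open>s\<^sup>2 \<equiv> - t\<^sup>2\<close> to
  this power gives \<open>1 \<equiv> - 1\<close> by Fermat, unless \<open>p\<close> divides \<open>s\<close> and \<open>t\<close>.
\<close>

lemma prime_3_mod_4_dvd_sum_of_squares:
  fixes s t :: int
  assumes "prime p" and "[p = 3] (mod 4)" and dvd: "int p dvd s\<^sup>2 + t\<^sup>2"
  shows "int p dvd s \<and> int p dvd t"
proof -
  have p: "prime (int p)" using assms(1) by simp
  have iff: "int p dvd s \<longleftrightarrow> int p dvd t"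
    using dvd p by (metis dvd_add_right_iff dvd_add_left_iff prime_dvd_power_iff zero_less_numeral)
  have "p mod 4 = 3" using assms(2) by (simp add: cong_def)
  then obtain k where k: "p = 4 * k + 3" by (metis mult_div_mod_eq)
  have "False" if "\<not> int p dvd s"
  proof -
    have "[s\<^sup>2 = - (t\<^sup>2)] (mod int p)"
      using dvd by (simp add: cong_iff_dvd_diff)
    then have "[(s\<^sup>2) ^ (2 * k + 1) = (- (t\<^sup>2)) ^ (2 * k + 1)] (mod int p)"
      by (rule cong_pow)
    moreover have "(y\<^sup>2) ^ (2 * k + 1) = y ^ (p - 1)" for y :: int
      using power_mult[of y 2 "2 * k + 1"] by (simp add: k)
    moreover have "(- (t\<^sup>2)) ^ (2 * k + 1) = - ((t\<^sup>2) ^ (2 * k + 1))"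
      by (rule power_minus_odd) simp
    ultimately have "[s ^ (p - 1) = - (t ^ (p - 1))] (mod int p)"
      by metis
    moreover have "[s ^ (p - 1) = 1] (mod int p)" "[- (t ^ (p - 1)) = - 1] (mod int p)"
      using fermat_int[OF assms(1)] that iff by (auto simp: cong_minus_minus_iff)
    ultimately have "[1 = - 1] (mod int p)"
      by (meson cong_sym cong_trans)
    then have "int p dvd 2" by (simp add: cong_iff_dvd_diff)
    then have "int p \<le> 2" by (rule zdvd_imp_le) simp
    then show False using k by simp
  qed
  then show ?thesis using iff by blast
qed

lemma multiplicity_prime_times:
  fixes p M :: nat
  assumes "prime p" and "M > 0"
  shows "multiplicity p (p * M) = Suc (multiplicity p M)"
  using assms by (intro multiplicity_times_same) auto

text \<open>
  If \<open>q\<close> divides \<open>N = s\<^sup>2 + t\<^sup>2\<close>, it divides both \<open>s\<close> and \<open>t\<close>, so \<open>N / q\<^sup>2\<close> is again a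
  sum of two squares, and the exponent of \<open>q\<close> has dropped by 2.
\<close>

lemma even_multiplicity_if_sum_of_two_squares:
  assumes "prime q" and "[q = 3] (mod 4)" and "N > 0" and "sum_of_two_squares (int N)"
  shows "even (multiplicity q N)"
  using assms(3,4)
proof (induction N rule: less_induct)
  case (less N)
  show ?case
  proof (cases "q dvd N")
    case False
    then show ?thesis by (simp add: not_dvd_imp_multiplicity_0)
  next
    case True
    obtain s t where st: "int N = s\<^sup>2 + t\<^sup>2"
      using less.prems unfolding sum_of_two_squares_def by blast
    have "int q dvd s\<^sup>2 + t\<^sup>2"
      using True by (simp flip: st)
    then obtain u v where uv: "s = int q * u" "t = int q * v"
      using prime_3_mod_4_dvd_sum_of_squares[OF assms(1,2)] by (meson dvdE)
    have eq: "int N = int q * (int q * (u\<^sup>2 + v\<^sup>2))"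
      by (simp add: st uv power2_eq_square algebra_simps)
    define M where "M = nat (u\<^sup>2 + v\<^sup>2)"
    have M: "int M = u\<^sup>2 + v\<^sup>2" by (simp add: M_def)
    have N: "N = q * (q * M)"
      using eq by (simp flip: M of_nat_mult)
    have "M > 0" using less.prems N by (cases M) auto
    moreover have "M < N"
    proof -
      have "1 * M < q * q * M"
        using \<open>M > 0\<close> prime_gt_1_nat[OF assms(1)] by (intro mult_strict_right_mono) (auto intro: one_less_mult)
      then show ?thesis by (simp add: N mult.assoc)
    qed
    moreover have "sum_of_two_squares (int M)"
      using M unfolding sum_of_two_squares_def by blast
    ultimately have "even (multiplicity q M)"
      using less.IH by blast
    moreover have "multiplicity q N = Suc (Suc (multiplicity q M))"
      using \<open>M > 0\<close> assms(1) by (simp add: N multiplicity_prime_times prime_gt_0_nat)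
    ultimately show ?thesis by simp
  qed
qed

lemma sqrt_minus_one_mod_prime:
  assumes "prime p" and "[p = 1] (mod 4)"
  obtains x :: int where "[x\<^sup>2 = - 1] (mod int p)"
proof -
  have "p > 2" 
    using assms prime_gt_1_nat[OF assms(1)] by (cases "p = 2") (auto simp: cong_def)
  have "p mod 4 = 1" using assms(2) by (simp add: cong_def)
  then have "even ((p - 1) div 2)" by presburger
  then have "[Legendre (- 1) p = 1] (mod p)"
    using euler_criterion[OF assms(1) \<open>p > 2\<close>, of "-1"] by simp
  moreover have "\<not> [0 = 1] (mod int p)" "\<not> [- 1 = 1] (mod int p)"
    using \<open>p > 2\<close> zdvd_imp_le[of "int p" 2] by (auto simp: cong_iff_dvd_diff)
  ultimately have "QuadRes p (- 1)"
    by (auto simp: Legendre_def split: if_splits)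
  then show ?thesis using that unfolding QuadRes_def by blast
qed

text \<open>
  Thue's lemma, by the pigeonhole principle: with \<open>m\<close> the integer part of the square root of \<open>p\<close>,
  there are \<open>(m + 1)\<^sup>2 > p\<close> pairs \<open>(i, j)\<close> with entries in \<open>{0..m}\<close>, so two of them have the same
  residue \<open>i - x j\<close>, and their difference is \<open>(u, v)\<close>. That \<open>p\<close> is not a square makes
  \<open>m\<^sup>2 < p\<close> strict.
\<close>

lemma thue:
  fixes x :: int
  assumes "p > 1" and "\<And>m :: nat. m * m \<noteq> p"
  obtains u v :: int where "[u = x * v] (mod int p)" "u\<^sup>2 < int p" "v\<^sup>2 < int p" "(u, v) \<noteq> (0, 0)"
proof -
  define m where "m = floor_sqrt p"
  have m: "m * m < p" "p < (m + 1) * (m + 1)"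
    using assms(2)[of m] floor_sqrt_power2_le[of p] Suc_floor_sqrt_power2_gt[of p]
    by (auto simp: m_def power2_eq_square)
  define f where "f = (\<lambda>(i, j). (int i - x * int j) mod int p)"
  have "f ` ({0..m} \<times> {0..m}) \<subseteq> {0..<int p}"
    using assms(1) by (auto simp: f_def)
  then have "card (f ` ({0..m} \<times> {0..m})) \<le> card {0..<int p}"
    by (intro card_mono) auto
  also have "\<dots> < card ({0..m} \<times> {0..m})"
    using m by (simp add: card_cartesian_product)
  finally have "\<not> inj_on f ({0..m} \<times> {0..m})"
    by (rule pigeonhole)
  then obtain i j k l where ijkl: "i \<le> m" "j \<le> m" "k \<le> m" "l \<le> m" "(i, j) \<noteq> (k, l)"
      "f (i, j) = f (k, l)"
    by (auto simp: inj_on_def)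
  define u v where "u = int i - int k" and "v = int j - int l"
  have small: "y\<^sup>2 < int p" if "\<bar>y\<bar> \<le> int m" for y
  proof -
    have "y\<^sup>2 \<le> (int m)\<^sup>2" using that by (simp add: abs_le_square_iff[symmetric])
    also have "\<dots> < int p" using m(1) by (simp add: power2_eq_square flip: of_nat_mult)
    finally show ?thesis .
  qed
  have "[int i - x * int j = int k - x * int l] (mod int p)"
    using ijkl by (simp add: f_def cong_def)
  then have "[u = x * v] (mod int p)"
    by (simp add: u_def v_def cong_iff_dvd_diff algebra_simps)
  moreover have "\<bar>u\<bar> \<le> int m" "\<bar>v\<bar> \<le> int m" "(u, v) \<noteq> (0, 0)"
    using ijkl by (auto simp: u_def v_def)
  ultimately show ?thesis using that small by blast
qed

text \<open>
  Applied to a square root \<open>x\<close> of \<open>- 1\<close> modulo \<open>p\<close>, Thue's lemma yields a multiple \<open>u\<^sup>2 + v\<^sup>2\<close>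
  of \<open>p\<close> strictly between \<open>0\<close> and \<open>2 p\<close>, which can only be \<open>p\<close>.
\<close>

lemma prime_1_mod_4_sum_of_two_squares:
  assumes "prime p" and "[p = 1] (mod 4)"
  shows "sum_of_two_squares (int p)"
proof -
  obtain x :: int where x: "[x\<^sup>2 = - 1] (mod int p)"
    using sqrt_minus_one_mod_prime[OF assms] .
  have "m * m \<noteq> p" for m
    using assms(1) by (metis prime_product not_prime_1 mult_1)
  then obtain u v where uv: "[u = x * v] (mod int p)" "u\<^sup>2 < int p" "v\<^sup>2 < int p" "(u, v) \<noteq> (0, 0)"
    using thue[of p x] prime_gt_1_nat[OF assms(1)] by blast
  have "[u\<^sup>2 = x\<^sup>2 * v\<^sup>2] (mod int p)"
    using cong_pow[OF uv(1), of 2] by (simp add: power_mult_distrib)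
  also have "[x\<^sup>2 * v\<^sup>2 = - 1 * v\<^sup>2] (mod int p)"
    using x by (rule cong_scalar_right)
  finally have "int p dvd u\<^sup>2 + v\<^sup>2"
    by (simp add: cong_iff_dvd_diff)
  then obtain c where c: "u\<^sup>2 + v\<^sup>2 = int p * c" by blast
  have "u\<^sup>2 + v\<^sup>2 > 0" using uv(4) by (simp add: sum_power2_gt_zero_iff)
  then have "c > 0" using c by (simp add: zero_less_mult_iff)
  moreover have "int p * c < int p * 2" using uv(2,3) c by linarith
  then have "c < 2" by (simp add: mult_less_cancel_left)
  ultimately have "c = 1" by simp
  then have "int p = u\<^sup>2 + v\<^sup>2"
    using c by simp
  then show ?thesis
    unfolding sum_of_two_squares_def by blast
qed

text \<open>
  Sums of two squares are closed under multiplication, so it suffices to split off factors that are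
  themselves sums of two squares and leave the parity of the relevant exponents unchanged: a prime
  \<open>p\<close> that is 2 or \<open>1\<close> modulo 4, or \<open>p\<^sup>2 = p\<^sup>2 + 0\<^sup>2\<close> when \<open>p \<equiv> 3 (mod 4)\<close>.
\<close>

lemma sum_of_two_squares_if_even_multiplicities:
  assumes "N > 0" and "\<And>q. prime q \<Longrightarrow> [q = 3] (mod 4) \<Longrightarrow> even (multiplicity q N)"
  shows "sum_of_two_squares (int N)"
  using assms
proof (induction N rule: less_induct)
  case (less N)
  show ?case
  proof (cases "N = 1")
    case True
    have "(1::int) = 1\<^sup>2 + 0\<^sup>2" by simp
    then show ?thesis unfolding sum_of_two_squares_def True of_nat_1 by blast
  next
    case False
    then obtain p where p: "prime p" "p dvd N"
      using prime_factor_nat by blast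
    then obtain M where M: "N = p * M" by blast
    have "M > 0" using less.prems(1) M by (cases M) auto
    have "p > 1" using p(1) by (rule prime_gt_1_nat)
    have smaller: "sum_of_two_squares (int L)" if "N = d * L" "d > 1"
      "\<And>q. prime q \<Longrightarrow> [q = 3] (mod 4) \<Longrightarrow> even (multiplicity q d)" for d L
    proof (rule less.IH)
      show L: "L > 0" using less.prems(1) that by (cases L) auto
      show "L < N" using that L by simp
      fix q :: nat assume q: "prime q" "[q = 3] (mod 4)"
      have "multiplicity q N = multiplicity q d + multiplicity q L"
        using that(1,2) L q by (simp add: prime_elem_multiplicity_mult_distrib)
      then show "even (multiplicity q L)"
        using less.prems(2)[OF q] that(3)[OF q] by simp
    qed
    show ?thesis
    proof (cases "[p = 3] (mod 4)")
      case True
      have "multiplicity p N = Suc (multiplicity p M)"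
        using p(1) \<open>M > 0\<close> by (simp add: M multiplicity_prime_times)
      then have "p dvd M"
        using less.prems(2)[OF p(1) True] not_dvd_imp_multiplicity_0 by fastforce
      then obtain L where "M = p * L" by blast
      then have L: "N = p\<^sup>2 * L"
        by (simp add: M power2_eq_square)
      have "sum_of_two_squares (int L)"
        using L
      proof (rule smaller)
        show "p\<^sup>2 > 1" using \<open>p > 1\<close> by (rule one_less_power) simp
        show "even (multiplicity q (p\<^sup>2))" if "prime q" for q
          using that \<open>p > 1\<close> by (simp add: prime_elem_multiplicity_power_distrib)
      qed
      moreover have "sum_of_two_squares (int (p\<^sup>2))"
        unfolding sum_of_two_squares_def by (intro exI[of _ "int p"] exI[of _ 0]) simp
      ultimately show ?thesis
        using sum_of_two_squares_mult by (simp add: L)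
    next
      case False
      have "sum_of_two_squares (int M)"
        using M \<open>p > 1\<close>
      proof (rule smaller)
        fix q :: nat assume "prime q" "[q = 3] (mod 4)"
        then show "even (multiplicity q p)"
          using False p(1) by (metis even_zero not_dvd_imp_multiplicity_0 primes_dvd_imp_eq)
      qed
      moreover have "sum_of_two_squares (int p)"
      proof (cases "p = 2")
        case True
        have "(2::int) = 1\<^sup>2 + 1\<^sup>2" by simp
        then show ?thesis unfolding sum_of_two_squares_def True of_nat_numeral by blast
      next
        case False
        then have "odd p" using p(1) \<open>p > 1\<close> prime_odd_nat by auto
        then have "[p = 1] (mod 4)"
          using \<open>\<not> [p = 3] (mod 4)\<close> unfolding cong_def by (simp; presburger)
        then show ?thesis by (rule prime_1_mod_4_sum_of_two_squares[OF p(1)])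
      qed
      ultimately show ?thesis
        using sum_of_two_squares_mult by (simp add: M)
    qed
  qed
qed

section \<open>The quotient of a power plus one by its base plus one\<close>

text \<open>
  The cofactor is kept as a natural number, because multiplicities are taken in \<^typ>\<open>nat\<close>, together
  with its alternating-sum form over \<^typ>\<open>int\<close>, which determines its residues.
\<close>

lemma power_plus_one_cofactor:
  fixes b m :: nat
  assumes "odd m"
  obtains Q :: nat where "b ^ m + 1 = (b + 1) * Q" "int Q = (\<Sum>i<m. (- int b) ^ i)"
proof -
  define S where "S = (\<Sum>i<m. (- int b) ^ i)"
  have eq: "int (b ^ m + 1) = int (b + 1) * S"
    using power_diff_1_eq[of "- int b" m] assms
    by (simp add: S_def algebra_simps)
  then have "int (b + 1) * S > 0"
    by (metis Suc_eq_plus1 of_nat_0_less_iff zero_less_Suc)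
  then have "S > 0"
    by (simp add: zero_less_mult_iff)
  then have "int (b ^ m + 1) = int ((b + 1) * nat S)"
    unfolding of_nat_mult using eq \<open>S > 0\<close> by simp
  then have "b ^ m + 1 = (b + 1) * nat S"
    by (simp only: of_nat_eq_iff)
  then show ?thesis using that[of "nat S"] \<open>S > 0\<close> by (simp add: S_def)
qed

text \<open>
  Modulo a divisor of \<open>b + 1\<close> each of the \<open>m\<close> terms \<open>(- b)\<^sup>i\<close> is 1.
\<close>

lemma cofactor_cong:
  assumes "int Q = (\<Sum>i<m. (- int b) ^ i)" and "r dvd b + 1"
  shows "[Q = m] (mod r)"
proof -
  have "[- int b = 1] (mod int r)"
    using assms(2) by (metis cong_iff_dvd_diff dvd_minus_iff int_dvd_int_iff minus_add_distrib
        minus_minus of_nat_1 of_nat_add uminus_add_conv_diff add.commute)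
  then have "[(\<Sum>i<m. (- int b) ^ i) = (\<Sum>i<m. 1 ^ i)] (mod int r)"
    by (intro cong_sum cong_pow)
  then show ?thesis
    by (simp flip: assms(1) add: cong_int_iff)
qed

lemma multiplicity_power_plus_one:
  fixes c m r :: nat
  assumes "odd m" and "prime r" and "r dvd c + 1" and "\<not> r dvd m"
  shows "multiplicity r (c ^ m + 1) = multiplicity r (c + 1)"
proof -
  obtain Q where Q: "c ^ m + 1 = (c + 1) * Q" "int Q = (\<Sum>i<m. (- int c) ^ i)"
    using power_plus_one_cofactor[OF assms(1)] .
  have "\<not> r dvd Q"
    using cofactor_cong[OF Q(2) assms(3)] assms(4) by (simp add: cong_dvd_iff cong_sym)
  then show ?thesis
    using assms(2) unfolding Q(1) mult.commute[of "c + 1"] by (intro multiplicity_prime_elem_times_other) auto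
qed

text \<open>
  Write \<open>b + 1 = q t\<close>. Modulo \<open>q\<^sup>2\<close> the binomial expansion gives \<open>(- b)\<^sup>i \<equiv> 1 - i q t\<close>, so \<open>Q\<close> is
  congruent to \<open>q - q t (0 + 1 + \<dots> + (q - 1)) = q - q t \<cdot> q (q - 1) / 2\<close>. For odd \<open>q\<close> the second
  term is a multiple of \<open>q\<^sup>2\<close>, and \<open>Q \<equiv> q\<close> modulo \<open>q\<^sup>2\<close>.
\<close>

lemma multiplicity_cofactor:
  assumes Q: "int Q = (\<Sum>i<q. (- int b) ^ i)" and "prime q" and "odd q" and "q dvd b + 1"
  shows "multiplicity q Q = 1"
proof (rule multiplicity_eqI)
  show "q ^ 1 dvd Q"
    using cofactor_cong[OF Q assms(4)] by (simp add: cong_dvd_iff cong_sym)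
next
  obtain t where t: "b + 1 = q * t" using assms(4) by blast
  then have b: "- int b = 1 - int q * int t"
    by (metis diff_add_cancel diff_diff_eq2 minus_diff_eq of_nat_1 of_nat_add of_nat_mult add_diff_cancel_right')
  define z where "z = int q * int t"
  have pow: "[(1 - z) ^ i = 1 - int i * z] (mod (int q)\<^sup>2)" for i
  proof (induction i)
    case (Suc i)
    have "[(1 - z) ^ Suc i = (1 - z) * (1 - int i * z)] (mod (int q)\<^sup>2)"
      using cong_scalar_left[OF Suc] by simp
    also have "(1 - z) * (1 - int i * z) - (1 - int (Suc i) * z) = (int q)\<^sup>2 * (int i * (int t)\<^sup>2)"
      by (simp add: z_def power2_eq_square algebra_simps)
    then have "[(1 - z) * (1 - int i * z) = 1 - int (Suc i) * z] (mod (int q)\<^sup>2)"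
      by (simp add: cong_iff_dvd_diff)
    finally show ?case .
  qed simp
  obtain k where k: "q = 2 * k + 1" using assms(3) by (elim oddE)
  have gauss: "2 * (\<Sum>i<m. int i) = int m * (int m - 1)" for m
    by (induction m) (simp_all add: algebra_simps)
  have "2 * (\<Sum>i<q. int i) = 2 * (int q * int k)"
    unfolding gauss by (simp add: k algebra_simps)
  then have sum: "(\<Sum>i<q. int i) = int q * int k" by simp
  have "[int Q = (\<Sum>i<q. 1 - int i * z)] (mod (int q)\<^sup>2)"
    unfolding Q b z_def[symmetric] by (intro cong_sum pow)
  also have "(\<Sum>i<q. 1 - int i * z) = int q - (int q)\<^sup>2 * (int k * int t)"
    by (simp add: sum_subtractf sum z_def power2_eq_square algebra_simps flip: sum_distrib_right)
  also have "[\<dots> = int q] (mod (int q)\<^sup>2)"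
    by (simp add: cong_iff_dvd_diff)
  finally have "[Q = q] (mod q\<^sup>2)"
    by (simp add: cong_int_iff flip: of_nat_power)
  then have "q\<^sup>2 dvd Q \<longleftrightarrow> q\<^sup>2 dvd q"
    by (simp add: cong_dvd_iff)
  then show "\<not> q ^ Suc 1 dvd Q"
    using prime_gt_1_nat[OF assms(2)] by (auto simp: power2_eq_square)
qed

section \<open>Primes dividing both the exponent and the power plus one\<close>

text \<open>
  The engine of the proof. Were \<open>n = e q\<close> with \<open>e > 1\<close>, the cofactor \<open>Q\<close> of \<open>a\<^sup>e + 1\<close> in
  \<open>a\<^sup>n + 1\<close> would have two incompatible residues modulo 4: it is 1 because \<open>a\<^sup>e\<close> is divisible by 4,
  and it is 3 because \<open>Q / q\<close> is an odd sum of two squares.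
\<close>

lemma exponent_eq_prime_divisor:
  fixes a n q :: nat
  assumes "even a" and "odd n" and sq: "sum_of_two_squares (int (a ^ n + 1))"
    and q: "prime q" "[q = 3] (mod 4)" and "q dvd n" and "q dvd a ^ n + 1"
  shows "n = q"
proof (rule ccontr)
  assume "n \<noteq> q"
  obtain e where e: "n = e * q" using \<open>q dvd n\<close> by (metis dvd_def mult.commute)
  have "e \<noteq> 0" "e \<noteq> 1" using e \<open>n \<noteq> q\<close> \<open>odd n\<close> by (auto intro!: Nat.gr0I)
  then have "e \<ge> 2" by simp
  have "odd q" using e \<open>odd n\<close> by simp
  define b where "b = a ^ e"
  have an: "a ^ n = b ^ q" by (simp add: e b_def power_mult)
  have "a ^ 2 dvd b" using \<open>e \<ge> 2\<close> by (simp add: b_def le_imp_power_dvd)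
  moreover have "2 ^ 2 dvd a ^ 2" using \<open>even a\<close> by (rule dvd_power_same)
  ultimately have "2 ^ 2 dvd b" by (rule dvd_trans[rotated])
  then have "4 dvd b" by simp
  \<comment> \<open>Fermat: passing from \<open>b\<^sup>q = a\<^sup>n\<close> to \<open>b\<close> does not change the residue modulo \<open>q\<close>.\<close>
  have "[b ^ q = b] (mod q)"
  proof (cases "q dvd b")
    case True
    then show ?thesis using prime_gt_0_nat[OF q(1)]
      by (simp add: cong_def mod_eq_0_iff_dvd dvd_power_iff dvd_trans[OF True] dvd_power)
  next
    case False
    have "[b * b ^ (q - 1) = b * 1] (mod q)"
      by (intro cong_scalar_left fermat_theorem q False)
    then show ?thesis using prime_gt_0_nat[OF q(1)] by (simp add: power_eq_if)
  qed
  then have "[b ^ q + 1 = b + 1] (mod q)" by (rule cong_add) simp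
  then have qb: "q dvd b + 1"
    using \<open>q dvd a ^ n + 1\<close> unfolding an by (simp add: cong_dvd_iff)
  obtain Q where Q: "b ^ q + 1 = (b + 1) * Q" "int Q = (\<Sum>i<q. (- int b) ^ i)"
    using power_plus_one_cofactor[OF \<open>odd q\<close>] .
  have mult_q: "multiplicity q Q = 1"
    by (rule multiplicity_cofactor[OF Q(2) q(1) \<open>odd q\<close> qb])
  then have "q dvd Q"
    by (metis not_dvd_imp_multiplicity_0 zero_neq_one)
  then obtain R where R: "Q = q * R" by blast
  have "Q > 0" using Q(1) by (cases Q) auto
  then have "R > 0" "q > 0" using R by auto
  have "sum_of_two_squares (int R)"
  proof (rule sum_of_two_squares_if_even_multiplicities[OF \<open>R > 0\<close>])
    fix r :: nat assume r: "prime r" "[r = 3] (mod 4)"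
    show "even (multiplicity r R)"
    proof (cases "r = q")
      case True
      then show ?thesis using mult_q q(1) \<open>R > 0\<close> by (simp add: R multiplicity_prime_times)
    next
      case False
      then have "\<not> r dvd q" using r(1) q(1) primes_dvd_imp_eq by blast
      then have RQ: "multiplicity r R = multiplicity r Q"
        using r(1) by (simp add: R multiplicity_prime_elem_times_other)
      show ?thesis
      proof (cases "r dvd Q")
        case True
        \<comment> \<open>Otherwise \<open>Q \<equiv> q\<close> modulo \<open>r\<close>, and \<open>r\<close> would divide \<open>q\<close>.\<close>
        have "\<not> r dvd b + 1"
          using cofactor_cong[OF Q(2), of r] True \<open>\<not> r dvd q\<close> by (auto simp: cong_dvd_iff)
        then have "multiplicity r (a ^ n + 1) = multiplicity r Q"
          using r(1) unfolding an Q(1) by (intro multiplicity_prime_elem_times_other) auto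
        then show ?thesis
          using even_multiplicity_if_sum_of_two_squares[OF r _ sq] RQ by simp
      next
        case False
        then show ?thesis by (simp add: RQ not_dvd_imp_multiplicity_0)
      qed
    qed
  qed
  moreover have Q4: "[Q = 1] (mod 4)"
  proof -
    have "[- int b = 0] (mod 4)"
      using \<open>4 dvd b\<close> by (simp add: cong_0_iff) presburger
    then have "[int Q = (\<Sum>i<q. 0 ^ i)] (mod 4)"
      unfolding Q(2) by (intro cong_sum cong_pow)
    also have "(\<Sum>i<q. 0 ^ i) = (1 :: int)"
      using \<open>q > 0\<close> by (simp add: power_0_left)
    finally show ?thesis
      by (metis cong_int_iff of_nat_1 of_nat_numeral)
  qed
  moreover have "odd R"
  proof -
    have "odd Q" using Q4 unfolding cong_def by simp presburger
    then show ?thesis using R by simp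
  qed
  ultimately have "[int R = 1] (mod 4)"
    by (intro odd_sum_of_two_squares_cong_1) auto
  then have "[R = 1] (mod 4)"
    by (metis cong_int_iff of_nat_1 of_nat_numeral)
  with q(2) have "[q * R = 3 * 1] (mod 4)"
    by (rule cong_mult)
  then show False
    using Q4 by (simp add: R cong_def)
qed

section \<open>Conclusion\<close>

lemma odd_exponent_prime_iff:
  assumes "N > 0"
  shows "odd_exponent_prime p N \<longleftrightarrow> prime p \<and> [p = 3] (mod 4) \<and> odd (multiplicity p N)"
proof -
  have "exactly_divides p r N \<longleftrightarrow> r = multiplicity p N" if "prime p" for r
  proof
    assume "exactly_divides p r N"
    then show "r = multiplicity p N"
      by (intro multiplicity_eqI[symmetric]) (auto simp: exactly_divides_def)
  next
    have "\<not> is_unit p" using that by auto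
    moreover assume "r = multiplicity p N"
    ultimately show "exactly_divides p r N"
      using assms by (simp add: exactly_divides_def multiplicity_dvd power_dvd_iff_le_multiplicity del: power_Suc)
  qed
  then show ?thesis unfolding odd_exponent_prime_def by metis
qed

theorem theorem1p2:
  fixes a n :: nat
  assumes "a > 0" and "n > 0" and "even a" and "odd n"
    and "sum_of_two_squares (int (a ^ n + 1))"
  shows "(sum_of_two_squares (int (a + 1)) \<longrightarrow>
           (\<forall>\<delta>>0. \<delta> dvd n \<longrightarrow> sum_of_two_squares (int (a ^ \<delta> + 1)))) \<and>
         (\<not> sum_of_two_squares (int (a + 1)) \<longrightarrow>
           (\<exists>p. odd_exponent_prime p (a + 1) \<and>
                (\<forall>q. odd_exponent_prime q (a + 1) \<longrightarrow> q = p) \<and> n = p))"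
proof (intro conjI impI allI)
  fix \<delta> :: nat
  assume a1: "sum_of_two_squares (int (a + 1))" and "\<delta> dvd n"
  then obtain m where m: "n = \<delta> * m" by blast
  have "odd m" using m \<open>odd n\<close> by simp
  show "sum_of_two_squares (int (a ^ \<delta> + 1))"
  proof (cases "\<delta> = 1 \<or> \<delta> = n")
    case True
    then show ?thesis using a1 assms(5) by auto
  next
    case False
    \<comment> \<open>Now \<open>n\<close> has a proper divisor other than 1, so it is not prime.\<close>
    show ?thesis
    proof (rule sum_of_two_squares_if_even_multiplicities)
      fix q :: nat
      assume q: "prime q" "[q = 3] (mod 4)"
      show "even (multiplicity q (a ^ \<delta> + 1))"
      proof (cases "q dvd a ^ \<delta> + 1")
        case True
        have an: "a ^ n + 1 = (a ^ \<delta>) ^ m + 1" by (simp add: m power_mult)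
        have "q dvd a ^ n + 1"
          using True power_plus_one_cofactor[OF \<open>odd m\<close>, of "a ^ \<delta>"] unfolding an
          by (metis dvd_mult2)
        have "\<not> q dvd n"
        proof
          assume "q dvd n"
          then have "n = q"
            using exponent_eq_prime_divisor[OF assms(3-5) q] \<open>q dvd a ^ n + 1\<close> by blast
          then show False
            using False \<open>\<delta> dvd n\<close> q(1) by (metis prime_nat_iff)
        qed
        then have "\<not> q dvd m" unfolding m by (rule contrapos_nn) (rule dvd_mult)
        have "multiplicity q (a ^ n + 1) = multiplicity q (a ^ \<delta> + 1)"
          unfolding an by (rule multiplicity_power_plus_one) fact+
        then show ?thesis
          using even_multiplicity_if_sum_of_two_squares[OF q _ assms(5)] by simp
      qed (simp add: not_dvd_imp_multiplicity_0)
    qed simp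
  qed
next
  assume not_sq: "\<not> sum_of_two_squares (int (a + 1))"
  have key: "n = p" if "odd_exponent_prime p (a + 1)" for p
  proof -
    have p: "prime p" "[p = 3] (mod 4)" "odd (multiplicity p (a + 1))"
      using that by (simp_all add: odd_exponent_prime_iff)
    then have pa: "p dvd a + 1" by (metis even_zero not_dvd_imp_multiplicity_0)
    have "p dvd n"
    proof (rule ccontr)
      assume "\<not> p dvd n"
      then have "multiplicity p (a ^ n + 1) = multiplicity p (a + 1)"
        using multiplicity_power_plus_one assms(4) p(1) pa by blast
      then show False
        using even_multiplicity_if_sum_of_two_squares[OF p(1,2) _ assms(5)] p(3) by simp
    qed
    moreover have "p dvd a ^ n + 1"
      using pa power_plus_one_cofactor[OF \<open>odd n\<close>, of a] by (metis dvd_mult2)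
    ultimately show ?thesis
      using exponent_eq_prime_divisor[OF assms(3-5) p(1,2)] by blast
  qed
  obtain p where "odd_exponent_prime p (a + 1)"
    using not_sq sum_of_two_squares_if_even_multiplicities[of "a + 1"]
    by (auto simp: odd_exponent_prime_iff)
  then show "\<exists>p. odd_exponent_prime p (a + 1) \<and>
      (\<forall>q. odd_exponent_prime q (a + 1) \<longrightarrow> q = p) \<and> n = p"
    using key by blast
qed

end
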